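(* Let $a_1,\dots,a_m\in\mathbb{C}^n$ be i.i.d. complex Gaussian random vectors, $a_j\sim \frac{1}{\sqrt2}\mathcal N(0,I_n)+\frac{i}{\sqrt2}\mathcal N(0,I_n)$, and let $y_j=|a_j^*x^\sharp|^2$, $j=1,\dots,m$, for a vector $x^\sharp\in\mathbb{C}^n$. For any $z_k\in\mathbb{C}^n$, the solution to the constrained Gauss-Newton problem $$\min_{\delta\in\mathbb{C}^n}\ \left\|A(z_k)\begin{bmatrix}\delta\\ \overline{\delta}\end{bmatrix}+F(z_k)\right\|_2^2\qquad\text{subject to}\qquad \operatorname{Im}(\delta^*z_k)=0$$ is $$\delta_k=-A(z_k)^\dagger F(z_k)(1:n).$$
   Context: For $z\in\mathbb{C}^n$, $A(z)\in\mathbb{C}^{m\times 2n}$ is the matrix whose $j$-th row is $\frac{1}{\sqrt m}\left[\,z^*a_ja_j^*,\ z^{\top}\bar a_ja_j^{\top}\right]$, and $F(z)=\frac{1}{\sqrt m}\left(|a_1^*z|^2-y_1,\dots,|a_m^*z|^2-y_m\right)^{\top}$. $A(z_k)^\dagger$ denotes the Moore-Penrose pseudoinverse of $A(z_k)$, and $A(z_k)^\dagger F(z_k)(1:n)$ denotes the vector consisting of the first through $n$-th entries of $A(z_k)^\dagger F(z_k)\in\mathbb{C}^{2n}$.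
   Formalization: δ_k is always a minimizer, and the unique one of least norm; "the solution" as the only minimizer is claimed almost surely for each fixed z_k ≠ 0 with m ≥ 2n−1, since uniqueness fails for z_k = 0 (then A = 0) and for m < 2n−1. *)

theory Defs
  imports "HOL-Probability.Probability"
begin

text \<open>Vectors in C^n are of type \<^typ>\<open>complex ^ 'n\<close>, sampling vectors are indexed by a finite
  type \<^typ>\<open>'m\<close>, and C^(2n) is \<^typ>\<open>complex ^ ('n + 'n)\<close>: the entries \<^term>\<open>Inl i\<close> are the first
  n ones, the entries \<^term>\<open>Inr i\<close> the last n ones. The norm on these types is the Euclidean
  norm.\<close>

text \<open>\<open>cdot u v\<close> is u^* v, conjugate linear in the first argument. The library's \<open>\<bullet>\<close> on
  \<^typ>\<open>complex ^ 'n\<close> is only the real part of this.\<close>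

definition cdot :: "complex ^ 'n::finite \<Rightarrow> complex ^ 'n \<Rightarrow> complex" where
  "cdot u v = (\<Sum>i\<in>UNIV. cnj (u $ i) * v $ i)"

definition adjoint_mat :: "complex ^ 'n ^ 'm \<Rightarrow> complex ^ 'm ^ 'n" where
  "adjoint_mat A = (\<chi> i j. cnj (A $ j $ i))"

definition is_pinv :: "complex ^ 'n::finite ^ 'm::finite \<Rightarrow> complex ^ 'm ^ 'n \<Rightarrow> bool" where
  "is_pinv A X \<longleftrightarrow>
     A ** X ** A = A \<and> X ** A ** X = X \<and>
     adjoint_mat (A ** X) = A ** X \<and> adjoint_mat (X ** A) = X ** A"

definition pinv :: "complex ^ 'n::finite ^ 'm::finite \<Rightarrow> complex ^ 'm ^ 'n" where
  "pinv A = (THE X. is_pinv A X)"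

definition with_conj :: "complex ^ 'n \<Rightarrow> complex ^ ('n + 'n)" where
  "with_conj d = (\<chi> s. case s of Inl i \<Rightarrow> d $ i | Inr i \<Rightarrow> cnj (d $ i))"

definition first_half :: "complex ^ ('n + 'n) \<Rightarrow> complex ^ 'n" where
  "first_half v = (\<chi> i. v $ Inl i)"

text \<open>In the second block, z^T conj(a_j) = a_j^* z.\<close>

definition gn_matrix ::
    "('m::finite \<Rightarrow> complex ^ 'n::finite) \<Rightarrow> complex ^ 'n \<Rightarrow> complex ^ ('n + 'n) ^ 'm" where
  "gn_matrix a z = (\<chi> j s. complex_of_real (1 / sqrt (real CARD('m))) *
     (case s of
        Inl i \<Rightarrow> cdot z (a j) * cnj (a j $ i)
      | Inr i \<Rightarrow> cdot (a j) z * a j $ i))"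

definition gn_residual ::
    "('m::finite \<Rightarrow> complex ^ 'n::finite) \<Rightarrow> ('m \<Rightarrow> real) \<Rightarrow> complex ^ 'n \<Rightarrow> complex ^ 'm" where
  "gn_residual a y z = (\<chi> j. complex_of_real
     (1 / sqrt (real CARD('m)) * ((cmod (cdot (a j) z))\<^sup>2 - y j)))"

definition gn_objective ::
    "('m::finite \<Rightarrow> complex ^ 'n::finite) \<Rightarrow> ('m \<Rightarrow> real) \<Rightarrow> complex ^ 'n \<Rightarrow> complex ^ 'n \<Rightarrow> real" where
  "gn_objective a y z d = (norm (gn_matrix a z *v with_conj d + gn_residual a y z))\<^sup>2"

definition gn_feasible :: "complex ^ 'n::finite \<Rightarrow> complex ^ 'n \<Rightarrow> bool" where
  "gn_feasible z d \<longleftrightarrow> Im (cdot d z) = 0"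

definition gn_solution ::
    "('m::finite \<Rightarrow> complex ^ 'n::finite) \<Rightarrow> ('m \<Rightarrow> real) \<Rightarrow> complex ^ 'n \<Rightarrow> complex ^ 'n \<Rightarrow> bool" where
  "gn_solution a y z d \<longleftrightarrow> is_arg_min (gn_objective a y z) (gn_feasible z) d"

definition gn_step ::
    "('m::finite \<Rightarrow> complex ^ 'n::finite) \<Rightarrow> ('m \<Rightarrow> real) \<Rightarrow> complex ^ 'n \<Rightarrow> complex ^ 'n" where
  "gn_step a y z = - first_half (pinv (gn_matrix a z) *v gn_residual a y z)"

definition std_gaussian_vector :: "'w measure \<Rightarrow> ('w \<Rightarrow> real ^ 'n::finite) \<Rightarrow> bool" where
  "std_gaussian_vector M g \<longleftrightarrow>
     prob_space.indep_vars M (\<lambda>_. borel) (\<lambda>i w. g w $ i) UNIV \<and>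
     (\<forall>i. distributed M lborel (\<lambda>w. g w $ i) (\<lambda>t. ennreal (std_normal_density t)))"

definition complex_gaussian_vector :: "'w measure \<Rightarrow> ('w \<Rightarrow> complex ^ 'n::finite) \<Rightarrow> bool" where
  "complex_gaussian_vector M X \<longleftrightarrow>
     (\<exists>g h. std_gaussian_vector M g \<and> std_gaussian_vector M h \<and>
        prob_space.indep_var M borel g borel h \<and>
        (\<forall>w\<in>space M. X w = (\<chi> i. Complex (g w $ i / sqrt 2) (h w $ i / sqrt 2))))"

end

theory Submission
  imports Defs
begin

text \<open>Put \<open>A\<close> and \<open>F\<close> for the Gauss-Newton matrix and residual. The point
  \<open>- A\<^sup>\<dagger> F\<close> is the least squares solution of minimal norm of \<open>A u + F \<approx> 0\<close> over
  all of \<open>\<complex>\<^sup>2\<^sup>n\<close>, without any constraint. Two symmetries show that it has the shape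
  that the constrained problem asks for.

  Applying the antilinear involution \<open>(u, v) \<mapsto> (cnj v, cnj u)\<close> to a vector conjugates its
  image under \<open>A\<close>, and \<open>F\<close> is real; so the involution permutes the least squares solutions and preserves norms. By
  uniqueness of the one of minimal norm, \<open>- A\<^sup>\<dagger> F\<close> is fixed, that is, of the form
  \<open>(\<delta>, cnj \<delta>)\<close> (\<open>with_conj_gn_step\<close>). The phase direction \<open>(z, - cnj z)\<close> is in the
  kernel of \<open>A\<close>, to which \<open>A\<^sup>\<dagger> F\<close> is orthogonal; this says \<open>Im (\<delta>\<^sup>* z) = 0\<close>
  (\<open>gn_feasible_gn_step\<close>). Being optimal among all vectors, \<open>\<delta>\<close> is optimal among the feasible
  ones, and any other solution has larger norm. This part holds for every sample.

  For the uniqueness, the difference \<open>d\<close> of two solutions satisfies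
  \<open>Re (z\<^sup>* a\<^sub>j a\<^sub>j\<^sup>* d) = 0\<close> for all \<open>j\<close> and is orthogonal over the reals to \<open>\<i> z\<close>.
  That these linear equations force \<open>d = 0\<close> is the nonvanishing of a real polynomial in the
  sampling vectors (\<open>det_frame_matrix_nonzero_iff\<close>). For \<open>z \<noteq> 0\<close> and \<open>m \<ge> 2 n - 1\<close> there are
  sampling vectors for which it does not vanish (\<open>gn_row_witness\<close>), and a nonzero polynomial
  in independent variables with densities is almost surely nonzero (\<open>generic_vec\<close>).\<close>

section \<open>The complex scalar product and adjoint matrices\<close>

lemma cdot_zero [simp]: "cdot u 0 = 0" "cdot 0 u = 0"
  by (simp_all add: cdot_def)

lemma cdot_add: "cdot u (v + w) = cdot u v + cdot u w" "cdot (v + w) u = cdot v u + cdot w u"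
  by (simp_all add: cdot_def algebra_simps sum.distrib)

lemma cdot_diff: "cdot u (v - w) = cdot u v - cdot u w" "cdot (v - w) u = cdot v u - cdot w u"
  by (simp_all add: cdot_def algebra_simps sum_subtractf)

lemma cdot_minus: "cdot u (- v) = - cdot u v" "cdot (- v) u = - cdot v u"
  by (simp_all add: cdot_def sum_negf)

lemma cnj_cdot: "cnj (cdot u v) = cdot v u"
  by (simp add: cdot_def mult.commute)

lemma inner_eq_Re_cdot: "u \<bullet> v = Re (cdot u v)"
  by (simp add: inner_vec_def cdot_def inner_complex_def)

lemma cdot_self: "cdot u u = complex_of_real ((norm u)\<^sup>2)"
proof (rule complex_eqI)
  show "Re (cdot u u) = Re (complex_of_real ((norm u)\<^sup>2))"
    by (simp add: inner_eq_Re_cdot [symmetric] power2_norm_eq_inner)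
  have "cnj (cdot u u) = cdot u u"
    by (rule cnj_cdot)
  then show "Im (cdot u u) = Im (complex_of_real ((norm u)\<^sup>2))"
    by (simp add: complex_eq_iff)
qed

lemma norm_add_cdot_orthogonal:
  assumes "cdot u v = 0"
  shows "(norm (u + v))\<^sup>2 = (norm u)\<^sup>2 + (norm v)\<^sup>2"
  using assms by (simp add: inner_eq_Re_cdot norm_add_Pythagorean orthogonal_def)

lemma cdot_matrix_vector: "cdot u (A *v v) = cdot (adjoint_mat A *v u) v"
  unfolding cdot_def adjoint_mat_def matrix_vector_mult_def
  by (simp add: sum_distrib_left sum_distrib_right) (subst sum.swap, simp add: mult_ac)

lemma adjoint_mat_adjoint_mat [simp]: "adjoint_mat (adjoint_mat A) = A"
  by (simp add: adjoint_mat_def vec_eq_iff)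

lemma adjoint_mat_mult: "adjoint_mat (A ** B) = adjoint_mat B ** adjoint_mat A"
  by (simp add: adjoint_mat_def matrix_matrix_mult_def vec_eq_iff mult.commute)

lemma matrix_vector_mult_uminus: "(A :: complex ^ 'n::finite ^ 'm::finite) *v (- v) = - (A *v v)"
  by (simp add: matrix_vector_mult_def vec_eq_iff sum_negf)

lemma matrix_vector_mult_axis:
  "(A :: complex ^ 'n::finite ^ 'm::finite) *v axis j 1 = (\<chi> i. A $ i $ j)"
  by (simp add: matrix_vector_mult_def vec_eq_iff axis_def if_distrib cong: if_cong)

section \<open>Pseudoinverse and least squares\<close>

text \<open>Project \<open>f\<close> orthogonally, over the reals, to the range of \<open>A\<close>. The residual \<open>r\<close> is then
  orthogonal to \<open>A A\<^sup>* r\<close>, so that \<open>A\<^sup>* r\<close> has norm zero.\<close>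

lemma normal_equations_solvable:
  fixes A :: "complex ^ 'n::finite ^ 'm::finite"
  shows "\<exists>v. adjoint_mat A *v f = adjoint_mat A *v (A *v v)"
proof -
  let ?R = "range (\<lambda>v. A *v v)"
  have lin: "linear (\<lambda>v. A *v v)"
  proof (rule linearI)
    show "A *v (u + v) = A *v u + A *v v" for u v
      by (rule matrix_vector_right_distrib)
    show "A *v (c *\<^sub>R u) = c *\<^sub>R (A *v u)" for c u
      by (simp add: matrix_vector_mult_def vec_eq_iff scaleR_sum_right)
  qed
  then have sub: "subspace ?R"
    by (simp add: linear_subspace_image)
  obtain p r where p: "p \<in> span ?R" and r: "\<And>w. w \<in> span ?R \<Longrightarrow> orthogonal r w"
    and f: "f = p + r"
    using orthogonal_subspace_decomp_exists [of ?R f] by metis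
  obtain v where v: "p = A *v v"
    using p sub by (auto simp: span_eq_iff [THEN iffD2])
  have "A *v (adjoint_mat A *v r) \<in> span ?R"
    by (simp add: span_base)
  then have "Re (cdot r (A *v (adjoint_mat A *v r))) = 0"
    using r by (simp add: orthogonal_def inner_eq_Re_cdot)
  then have "adjoint_mat A *v r = 0"
    by (simp add: cdot_matrix_vector cdot_self)
  then show ?thesis
    by (intro exI [of _ v]) (simp add: f v matrix_vector_right_distrib)
qed

text \<open>Solving the normal equations for each unit vector and collecting the solutions as columns
  gives a matrix \<open>S\<close> for which \<open>A S\<close> is the orthogonal projection to the range of \<open>A\<close>.\<close>

lemma adjoint_mat_factor:
  fixes A :: "complex ^ 'n::finite ^ 'm::finite"
  shows "\<exists>S. adjoint_mat A = adjoint_mat A ** A ** S"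
proof -
  obtain v where v: "\<And>f. adjoint_mat A *v f = adjoint_mat A *v (A *v v f)"
    using normal_equations_solvable [of A] by metis
  define S where "S = (\<chi> i j. v (axis j 1) $ i)"
  have "S *v axis j 1 = v (axis j 1)" for j
    by (simp add: S_def vec_eq_iff matrix_vector_mult_axis)
  then have "adjoint_mat A *v axis j 1 = (adjoint_mat A ** A ** S) *v axis j 1" for j
    by (simp add: matrix_vector_mul_assoc [symmetric] v [symmetric])
  then have "adjoint_mat A = adjoint_mat A ** A ** S"
    by (simp add: matrix_vector_mult_axis vec_eq_iff)
  then show ?thesis ..
qed

text \<open>The factorisation of \<open>A\<^sup>*\<close> gives \<open>S\<close> with \<open>A S A = A\<close> and \<open>A S\<close> Hermitian; the one of
  \<open>A\<close>, after taking adjoints, gives \<open>L\<close> with \<open>A L A = A\<close> and \<open>L A\<close> Hermitian. Their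
  combination \<open>L A S\<close> has all four Penrose properties.\<close>

lemma is_pinv_exists: "\<exists>X. is_pinv A X"
proof -
  obtain S where S: "adjoint_mat A = adjoint_mat A ** A ** S"
    using adjoint_mat_factor by blast
  obtain R where "adjoint_mat (adjoint_mat A) = adjoint_mat (adjoint_mat A) ** adjoint_mat A ** R"
    using adjoint_mat_factor by blast
  then have R: "A = A ** adjoint_mat A ** R"
    by simp
  define L where "L = adjoint_mat R"
  have AL: "adjoint_mat A = L ** A ** adjoint_mat A"
    using arg_cong [OF R, of adjoint_mat] by (simp add: adjoint_mat_mult L_def matrix_mul_assoc)
  have SA: "A = adjoint_mat S ** adjoint_mat A ** A"
    using arg_cong [OF S, of adjoint_mat] by (simp add: adjoint_mat_mult matrix_mul_assoc)
  have "A ** S = adjoint_mat S ** adjoint_mat A ** A ** S"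
    using SA by simp
  also have "\<dots> = adjoint_mat S ** adjoint_mat A"
    by (subst (2) S) (simp add: matrix_mul_assoc)
  finally have AS: "adjoint_mat (A ** S) = A ** S"
    by (simp add: adjoint_mat_mult)
  have "A ** S ** A = adjoint_mat (A ** S) ** A"
    by (simp add: AS)
  then have ASA: "A ** S ** A = A"
    using SA by (simp add: adjoint_mat_mult)
  have "L ** A = L ** A ** adjoint_mat A ** R"
    using R by (metis matrix_mul_assoc)
  also have "\<dots> = adjoint_mat A ** R"
    using AL by simp
  finally have LA: "adjoint_mat (L ** A) = L ** A"
    by (simp add: adjoint_mat_mult L_def)
  have "A ** (L ** A) = A ** adjoint_mat (L ** A)"
    by (simp add: LA)
  then have ALA: "A ** (L ** A) = A"
    using R by (simp add: adjoint_mat_mult L_def matrix_mul_assoc)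
  define X where "X = L ** A ** S"
  have AX: "A ** X = A ** S" and XA: "X ** A = L ** A"
    using ALA ASA by (simp_all add: X_def matrix_mul_assoc) (metis matrix_mul_assoc)
  have "X ** A ** X = L ** (A ** X)"
    by (simp add: XA matrix_mul_assoc)
  then have XAX: "X ** A ** X = X"
    by (simp add: AX) (simp add: X_def matrix_mul_assoc)
  then have "is_pinv A X"
    unfolding is_pinv_def using AX XA AS LA ASA XAX by simp
  then show ?thesis ..
qed

text \<open>\<open>A X\<close> and \<open>A Y\<close> are Hermitian projections to the same range: each absorbs the other on
  the left, and taking adjoints shows that they are equal. The same holds for \<open>X A\<close> and
  \<open>Y A\<close>.\<close>

lemma is_pinv_unique:
  assumes X: "is_pinv A X" and Y: "is_pinv A Y"
  shows "X = Y"
proof -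
  have "A ** X = A ** Y ** (A ** X)"
    using Y by (metis is_pinv_def matrix_mul_assoc)
  also have "\<dots> = adjoint_mat (A ** X ** (A ** Y))"
    using X Y by (metis is_pinv_def adjoint_mat_mult)
  also have "\<dots> = A ** Y"
    using X Y by (metis is_pinv_def matrix_mul_assoc)
  finally have AX: "A ** X = A ** Y" .
  have "X ** A = X ** A ** (Y ** A)"
    using Y by (metis is_pinv_def matrix_mul_assoc)
  also have "\<dots> = adjoint_mat (Y ** A ** (X ** A))"
    using X Y by (metis is_pinv_def adjoint_mat_mult)
  also have "\<dots> = Y ** A"
    using X Y by (metis is_pinv_def matrix_mul_assoc)
  finally have XA: "X ** A = Y ** A" .
  have "X = X ** A ** X"
    using X by (simp add: is_pinv_def)
  also have "\<dots> = Y ** A ** Y"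
    using AX XA by (metis matrix_mul_assoc)
  finally show ?thesis
    using Y by (simp add: is_pinv_def)
qed

lemma is_pinv_pinv: "is_pinv A (pinv A)"
  unfolding pinv_def using is_pinv_exists is_pinv_unique by (metis theI)

lemma pinv_residual_orthogonal: "adjoint_mat A *v (A *v (pinv A *v f)) = adjoint_mat A *v f"
proof -
  have "adjoint_mat A = adjoint_mat (A ** pinv A ** A)"
    using is_pinv_pinv [of A] by (simp add: is_pinv_def)
  also have "\<dots> = adjoint_mat A ** (A ** pinv A)"
    using is_pinv_pinv [of A] by (metis is_pinv_def adjoint_mat_mult)
  finally show ?thesis
    by (metis matrix_vector_mul_assoc)
qed

text \<open>\<open>pinv A ** A\<close> is Hermitian, so that the range of \<open>pinv A\<close> is orthogonal to the kernel of
  \<open>A\<close>. This yields both the minimality of the norm and the constraint of the Gauss-Newton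
  problem.\<close>

lemma cdot_kernel_pinv:
  assumes "A *v k = 0"
  shows "cdot k (pinv A *v f) = 0"
proof -
  have "pinv A *v f = (pinv A ** A) *v (pinv A *v f)"
    using is_pinv_pinv [of A] by (simp add: is_pinv_def matrix_vector_mul_assoc)
  then have "cdot k (pinv A *v f) = cdot (pinv A *v (A *v k)) (pinv A *v f)"
    using is_pinv_pinv [of A]
    by (metis cdot_matrix_vector is_pinv_def matrix_vector_mul_assoc)
  then show ?thesis
    using assms by simp
qed

text \<open>The residual at \<open>- pinv A *v f\<close> solves the normal equations, so it is orthogonal to the
  range of \<open>A\<close>. Hence the minimisers of \<open>norm (A *v u + f)\<close> are exactly the \<open>u\<close> that
  differ from this point by a kernel vector.\<close>

lemma least_squares_pythagoras:
  "(norm (A *v u + f))\<^sup>2 =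
     (norm (A *v (u + pinv A *v f)))\<^sup>2 + (norm (A *v (- (pinv A *v f)) + f))\<^sup>2"
proof -
  let ?r = "A *v (- (pinv A *v f)) + f"
  have "adjoint_mat A *v ?r = 0"
    using pinv_residual_orthogonal [of A f]
    by (simp add: matrix_vector_right_distrib matrix_vector_mult_diff_distrib
        matrix_vector_mult_uminus algebra_simps)
  then have "cdot ?r (A *v (u + pinv A *v f)) = 0"
    by (simp add: cdot_matrix_vector)
  then have "cdot (A *v (u + pinv A *v f)) ?r = 0"
    by (metis cnj_cdot complex_cnj_zero)
  moreover have "A *v u + f = A *v (u + pinv A *v f) + ?r"
    by (simp add: matrix_vector_right_distrib matrix_vector_mult_uminus)
  ultimately show ?thesis
    using norm_add_cdot_orthogonal by metis
qed

lemma least_squares_min_norm: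
  assumes "A *v (u + pinv A *v f) = 0"
  shows "(norm u)\<^sup>2 = (norm (u + pinv A *v f))\<^sup>2 + (norm (pinv A *v f))\<^sup>2"
  using norm_add_cdot_orthogonal [of "u + pinv A *v f" "- (pinv A *v f)"]
    cdot_kernel_pinv [OF assms, of f]
  by (simp add: cdot_minus)

section \<open>Symmetry and solutions of the Gauss-Newton problem\<close>

lemma sum_UNIV_sum:
  "(\<Sum>s\<in>(UNIV :: ('a::finite + 'b::finite) set). f s) = (\<Sum>i\<in>UNIV. f (Inl i)) + (\<Sum>i\<in>UNIV. f (Inr i))"
  unfolding UNIV_Plus_UNIV [symmetric] by (subst sum.Plus) simp_all

text \<open>The antilinear involution of \<open>\<complex>\<^sup>2\<^sup>n\<close> whose fixed points are the vectors
  \<open>with_conj d\<close>. It is the symmetry that turns the problem on \<open>\<complex>\<^sup>2\<^sup>n\<close> into the one for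
  \<open>d\<close>.\<close>

definition conj_swap :: "complex ^ ('n::finite + 'n) \<Rightarrow> complex ^ ('n + 'n)" where
  "conj_swap u = (\<chi> s. case s of Inl i \<Rightarrow> cnj (u $ Inr i) | Inr i \<Rightarrow> cnj (u $ Inl i))"

lemma conj_swap_conj_swap [simp]: "conj_swap (conj_swap u) = u"
  by (simp add: conj_swap_def vec_eq_iff split: sum.split)

lemma first_half_with_conj [simp]: "first_half (with_conj d) = d"
  by (simp add: first_half_def with_conj_def vec_eq_iff)

lemma conj_swap_with_conj [simp]: "conj_swap (with_conj d) = with_conj d"
  by (simp add: conj_swap_def with_conj_def vec_eq_iff split: sum.split)

lemma with_conj_first_half: "conj_swap u = u \<Longrightarrow> with_conj (first_half u) = u"
  by (auto simp: conj_swap_def first_half_def with_conj_def vec_eq_iff split: sum.split)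
     (metis sum.simps(6))

lemma with_conj_diff: "with_conj (d - e) = with_conj d - with_conj e"
  by (simp add: with_conj_def vec_eq_iff split: sum.split)

lemma cdot_halves:
  "cdot u v = cdot (first_half u) (first_half v)
     + cnj (cdot (first_half (conj_swap u)) (first_half (conj_swap v)))"
  by (simp add: cdot_def first_half_def conj_swap_def sum_UNIV_sum)

lemma cdot_conj_swap: "cdot (conj_swap u) (conj_swap v) = cnj (cdot u v)"
  by (simp add: cdot_halves [of "conj_swap u"] cdot_halves [of u])

lemma norm_conj_swap: "(norm (conj_swap u))\<^sup>2 = (norm u)\<^sup>2"
  using cdot_conj_swap [of u u] by (simp add: cdot_self flip: of_real_power)

lemma norm_with_conj: "(norm (with_conj d))\<^sup>2 = 2 * (norm d)\<^sup>2"
proof -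
  have "complex_of_real ((norm (with_conj d))\<^sup>2) = complex_of_real (2 * (norm d)\<^sup>2)"
    unfolding cdot_self [symmetric] cdot_halves [of "with_conj d"] by (simp add: cdot_self)
  then show ?thesis
    by (simp only: of_real_eq_iff)
qed

text \<open>The second block of a row is the conjugate of the first one. In terms of \<open>conj_swap\<close> this
  shows at once that the rows are real on vectors \<open>with_conj d\<close>.\<close>

lemma gn_matrix_mult_nth:
  fixes a :: "'m::finite \<Rightarrow> complex ^ 'n::finite"
  shows "(gn_matrix a z *v u) $ j = complex_of_real (1 / sqrt (real CARD('m))) *
     (cdot z (a j) * cdot (a j) (first_half u)
       + cnj (cdot z (a j) * cdot (a j) (first_half (conj_swap u))))"
  unfolding cnj_cdot complex_cnj_mult
  by (simp add: gn_matrix_def matrix_vector_mult_def sum_UNIV_sum cdot_def first_half_def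
      conj_swap_def sum_distrib_left sum_divide_distrib algebra_simps)

lemma gn_matrix_with_conj_eq_0_iff:
  fixes a :: "'m::finite \<Rightarrow> complex ^ 'n::finite"
  shows "gn_matrix a z *v with_conj d = 0 \<longleftrightarrow> (\<forall>j. Re (cdot z (a j) * cdot (a j) d) = 0)"
  by (simp add: vec_eq_iff gn_matrix_mult_nth complex_add_cnj del: complex_cnj_mult times_complex.simps)

lemma gn_matrix_conj_swap: "(gn_matrix a z *v conj_swap u) $ j = cnj ((gn_matrix a z *v u) $ j)"
  by (simp add: gn_matrix_mult_nth add.commute)

text \<open>The residual vector \<open>F\<close> is real, so \<open>conj_swap\<close> preserves the unconstrained least
  squares objective; it also preserves the norm. Hence it fixes the unique least squares
  solution of minimal norm, which therefore is of the form \<open>with_conj d\<close>.\<close>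

lemma with_conj_gn_step:
  "with_conj (gn_step a y z) = - (pinv (gn_matrix a z) *v gn_residual a y z)"
proof -
  let ?A = "gn_matrix a z" and ?F = "gn_residual a y z"
  define u where "u = - (pinv ?A *v ?F)"
  have "(?A *v conj_swap u + ?F) $ j = cnj ((?A *v u + ?F) $ j)" for j
    by (simp add: gn_matrix_conj_swap gn_residual_def)
  then have "norm ((?A *v conj_swap u + ?F) $ j) = norm ((?A *v u + ?F) $ j)" for j
    by (metis complex_mod_cnj)
  then have "(norm (?A *v conj_swap u + ?F))\<^sup>2 = (norm (?A *v u + ?F))\<^sup>2"
    unfolding norm_vec_def by presburger
  then have ker: "?A *v (conj_swap u + pinv ?A *v ?F) = 0"
    using least_squares_pythagoras [of ?A "conj_swap u" ?F] by (simp add: u_def)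
  have "(norm (conj_swap u))\<^sup>2 = (norm (pinv ?A *v ?F))\<^sup>2"
    by (simp add: norm_conj_swap u_def)
  then have "conj_swap u = u"
    using least_squares_min_norm [OF ker] by (simp add: u_def eq_neg_iff_add_eq_0)
  then show ?thesis
    using with_conj_first_half [of u]
    by (simp add: gn_step_def u_def first_half_def vec_eq_iff with_conj_def split: sum.splits)
qed

text \<open>A change of phase of \<open>z\<close> leaves all \<open>\<bar>a\<^sub>j\<^sup>* z\<bar>\<close> unchanged, so its tangent
  direction \<open>with_conj (\<i> z) = \<i> (z, - cnj z)\<close> belongs to the kernel of the Gauss-Newton matrix. The pseudoinverse solution is
  orthogonal to \<open>(z, - cnj z)\<close>, and for a vector \<open>with_conj d\<close> this is the constraint.\<close>

lemma gn_feasible_gn_step: "gn_feasible z (gn_step a y z)"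
proof -
  define k where "k = (\<chi> s. case s of Inl i \<Rightarrow> z $ i | Inr i \<Rightarrow> - cnj (z $ i))"
  have half: "first_half k = z" and swap: "conj_swap k = - k"
    by (simp_all add: k_def first_half_def conj_swap_def vec_eq_iff split: sum.split)
  have first_half_minus: "first_half (- v) = - first_half v" for v :: "complex ^ ('n::finite + 'n)"
    by (simp add: first_half_def vec_eq_iff)
  have "gn_matrix a z *v k = 0"
    by (simp add: vec_eq_iff gn_matrix_mult_nth half swap first_half_minus cdot_minus cnj_cdot)
  then have "cdot k (with_conj (gn_step a y z)) = 0"
    by (simp add: with_conj_gn_step cdot_minus cdot_kernel_pinv)
  then have "cdot z (gn_step a y z) - cnj (cdot z (gn_step a y z)) = 0"
    unfolding cdot_halves [of k] by (simp add: half swap first_half_minus cdot_minus)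
  then have "Im (cdot z (gn_step a y z)) = 0"
    by (simp add: complex_eq_iff)
  then have "Im (cnj (cdot z (gn_step a y z))) = 0"
    by simp
  then show ?thesis
    unfolding gn_feasible_def cnj_cdot .
qed

text \<open>Pythagoras on \<open>\<complex>\<^sup>2\<^sup>n\<close>, restricted to vectors \<open>with_conj d\<close>: it makes
  \<open>gn_step\<close> a minimiser and describes all others.\<close>

lemma gn_objective_eq:
  "gn_objective a y z d
     = (norm (gn_matrix a z *v with_conj (d - gn_step a y z)))\<^sup>2
       + gn_objective a y z (gn_step a y z)"
  using least_squares_pythagoras [of "gn_matrix a z" "with_conj d" "gn_residual a y z"]
  by (simp add: gn_objective_def with_conj_diff with_conj_gn_step)

lemma gn_solution_iff:
  "gn_solution a y z d \<longleftrightarrow>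
     gn_feasible z d \<and> gn_matrix a z *v with_conj (d - gn_step a y z) = 0"
proof
  assume "gn_solution a y z d"
  then have "gn_feasible z d" "gn_objective a y z d \<le> gn_objective a y z (gn_step a y z)"
    using gn_feasible_gn_step [of z a y] by (auto simp: gn_solution_def is_arg_min_def not_less)
  then show "gn_feasible z d \<and> gn_matrix a z *v with_conj (d - gn_step a y z) = 0"
    using gn_objective_eq [of a y z d] by simp
next
  assume "gn_feasible z d \<and> gn_matrix a z *v with_conj (d - gn_step a y z) = 0"
  moreover from this have "gn_objective a y z d = gn_objective a y z (gn_step a y z)"
    using gn_objective_eq [of a y z d] by simp
  moreover have "gn_objective a y z (gn_step a y z) \<le> gn_objective a y z e" for e
    using gn_objective_eq [of a y z e] by simp
  ultimately show "gn_solution a y z d"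
    by (simp add: gn_solution_def is_arg_min_def not_less)
qed

lemma gn_solution_gn_step: "gn_solution a y z (gn_step a y z)"
  by (simp add: gn_solution_iff gn_feasible_gn_step gn_matrix_with_conj_eq_0_iff)

lemma gn_step_min_norm:
  assumes "gn_solution a y z d" and "d \<noteq> gn_step a y z"
  shows "norm (gn_step a y z) < norm d"
proof -
  let ?A = "gn_matrix a z" and ?F = "gn_residual a y z"
  have step: "with_conj (d - gn_step a y z) = with_conj d + pinv ?A *v ?F"
    by (simp add: with_conj_diff with_conj_gn_step)
  then have "?A *v (with_conj d + pinv ?A *v ?F) = 0"
    using assms(1) by (simp add: gn_solution_iff)
  from least_squares_min_norm [OF this]
  have "(norm (with_conj d))\<^sup>2
      = (norm (with_conj (d - gn_step a y z)))\<^sup>2 + (norm (with_conj (gn_step a y z)))\<^sup>2"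
    by (simp add: step with_conj_gn_step)
  then have "(norm d)\<^sup>2 = (norm (d - gn_step a y z))\<^sup>2 + (norm (gn_step a y z))\<^sup>2"
    by (simp add: norm_with_conj)
  then have "(norm (gn_step a y z))\<^sup>2 < (norm d)\<^sup>2"
    using assms(2) by simp
  then show ?thesis
    by (rule power_less_imp_less_base) simp
qed

section \<open>Random vectors avoiding the zeros of polynomials\<close>

text \<open>\<open>X\<close> lies almost surely outside the zero set of any given nonzero polynomial. The absolutely
  continuous laws have this property, and it passes from the components to a vector by a
  direct Fubini argument, which dispenses with joint densities.\<close>

definition generic :: "'w measure \<Rightarrow> ('w \<Rightarrow> 'a::real_normed_vector) \<Rightarrow> bool" where
  "generic M X \<longleftrightarrow>
     (\<forall>f x. real_polynomial_function f \<longrightarrow> f x \<noteq> 0 \<longrightarrow> (AE w in M. f (X w) \<noteq> 0))"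

lemma genericD:
  "generic M X \<Longrightarrow> real_polynomial_function f \<Longrightarrow> f x \<noteq> 0 \<Longrightarrow> AE w in M. f (X w) \<noteq> 0"
  unfolding generic_def by blast

lemma real_polynomial_function_comp:
  "polynomial_function g \<Longrightarrow> real_polynomial_function f \<Longrightarrow> real_polynomial_function (\<lambda>x. f (g x))"
  using real_polynomial_function_compose [of g f] by (simp add: o_def)

lemma borel_measurable_real_polynomial_function:
  "real_polynomial_function f \<Longrightarrow> f \<in> borel_measurable borel"
  by (intro borel_measurable_continuous_onI)
     (simp add: continuous_at_imp_continuous_on continuous_real_polymonial_function)

lemma finite_zeros_real_polynomial_function:
  fixes f :: "real \<Rightarrow> real"
  assumes "real_polynomial_function f" "f x \<noteq> 0"
  shows "finite {t. f t = 0}"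
proof -
  obtain c n where f: "f = (\<lambda>t. \<Sum>i\<le>n. c i * t ^ i)"
    using assms(1) by (auto simp: real_polynomial_function_iff_sum)
  have "\<exists>i\<le>n. c i \<noteq> 0"
    using assms(2) unfolding f by (metis (no_types, lifting) atMost_iff mult_zero_left sum.neutral)
  then show ?thesis
    by (auto simp: f polyfun_finite_roots)
qed

lemma generic_if_density:
  assumes "distributed M lborel (X :: 'w \<Rightarrow> real) p"
  shows "generic M X"
  unfolding generic_def
proof (intro allI impI)
  fix f :: "real \<Rightarrow> real" and x
  assume "real_polynomial_function f" "f x \<noteq> 0"
  then have "{t. f t = 0} \<in> null_sets lborel"
    by (intro finite_imp_null_set_lborel finite_zeros_real_polynomial_function)
  then have "AE t in lborel. f t \<noteq> 0"
    using AE_not_in by fastforce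
  then have "AE t in density lborel p. f t \<noteq> 0"
    using assms by (subst AE_density) (auto simp: distributed_def)
  moreover have "distr M lborel X = density lborel p"
    using assms by (simp add: distributed_def)
  ultimately have "AE t in distr M lborel X. f t \<noteq> 0"
    by metis
  then show "AE w in M. f (X w) \<noteq> 0"
    using assms by (intro AE_distrD [of X M lborel]) (auto simp: distributed_def)
qed

text \<open>Independence makes the joint law a product measure, so by Fubini's theorem an almost sure
  property may be checked on two separate sample points.\<close>

lemma (in prob_space) AE_indep_decouple:
  assumes indep: "indep_var S X T Y"
    and meas: "{q \<in> space (S \<Otimes>\<^sub>M T). P q} \<in> sets (S \<Otimes>\<^sub>M T)"
    and ae: "AE w in M. AE w' in M. P (X w, Y w')"
  shows "AE w in M. P (X w, Y w)"
proof -
  have [measurable]: "random_variable S X" "random_variable T Y"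
    and joint: "distr M S X \<Otimes>\<^sub>M distr M T Y = distr M (S \<Otimes>\<^sub>M T) (\<lambda>w. (X w, Y w))"
    using indep unfolding indep_var_distribution_eq by auto
  have [measurable]: "Measurable.pred (S \<Otimes>\<^sub>M T) P"
    using meas by (simp add: pred_def)
  interpret PX: prob_space "distr M S X" by (rule prob_space_distr) measurable
  interpret PY: prob_space "distr M T Y" by (rule prob_space_distr) measurable
  interpret P: pair_prob_space "distr M S X" "distr M T Y" ..
  have "AE t in distr M T Y. P (X w, t)" if "w \<in> space M" "AE w' in M. P (X w, Y w')" for w
  proof -
    have [measurable]: "X w \<in> space S"
      using that(1) \<open>random_variable S X\<close> by (rule measurable_space [rotated])
    show ?thesis
      using that(2) by (subst AE_distr_iff) auto
  qed
  with ae have "AE w in M. AE t in distr M T Y. P (X w, t)"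
    by (metis (mono_tags, lifting) AE_mp AE_I2)
  moreover have "{u \<in> space S. AE t in distr M T Y. P (u, t)} \<in> sets S"
  proof -
    define B where "B = {q \<in> space (S \<Otimes>\<^sub>M T). \<not> P q}"
    have "B \<in> sets (S \<Otimes>\<^sub>M distr M T Y)"
      by (simp add: B_def cong: sets_pair_measure_cong)
    from PY.measurable_emeasure_Pair [OF this]
    have [measurable]: "(\<lambda>u. emeasure (distr M T Y) (Pair u -` B)) \<in> borel_measurable S" .
    have "(AE t in distr M T Y. P (u, t)) \<longleftrightarrow> emeasure (distr M T Y) (Pair u -` B) = 0"
      if [measurable]: "u \<in> space S" for u
      using that by (intro AE_iff_measurable) (auto simp: B_def space_pair_measure)
    then have "{u \<in> space S. AE t in distr M T Y. P (u, t)}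
        = {u \<in> space S. emeasure (distr M T Y) (Pair u -` B) = 0}"
      by blast
    also have "\<dots> \<in> sets S"
      by measurable
    finally show ?thesis .
  qed
  ultimately have "AE u in distr M S X. AE t in distr M T Y. P (u, t)"
    by (subst AE_distr_iff) auto
  then have "AE q in distr M S X \<Otimes>\<^sub>M distr M T Y. P q"
    using meas by (intro P.AE_pair_measure) (auto simp: space_pair_measure)
  then show ?thesis
    unfolding joint by (rule AE_distrD [rotated]) measurable
qed

lemma generic_compose:
  fixes X :: "'w \<Rightarrow> 'a::real_normed_vector" and Y :: "'w \<Rightarrow> 'b::real_normed_vector"
  assumes "generic M X" "polynomial_function L" "surj L"
    and "\<And>w. w \<in> space M \<Longrightarrow> Y w = L (X w)"
  shows "generic M Y"
  unfolding generic_def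
proof (intro allI impI)
  fix f :: "'b \<Rightarrow> real" and y
  assume f: "real_polynomial_function f" "f y \<noteq> 0"
  obtain x where "y = L x"
    using assms(3) by blast
  then have "AE w in M. f (L (X w)) \<noteq> 0"
    using genericD [OF assms(1) real_polynomial_function_comp [OF assms(2) f(1)], of x] f(2)
    by simp
  then show "AE w in M. f (Y w) \<noteq> 0"
    by (rule AE_mp) (simp add: assms(4))
qed

lemma polynomial_function_Pair_const:
  "polynomial_function (\<lambda>u :: 'a::real_normed_vector. (u, c :: 'b::real_normed_vector))"
  "polynomial_function (\<lambda>u :: 'a::real_normed_vector. (c :: 'b::real_normed_vector, u))"
proof -
  have "polynomial_function (\<lambda>u :: 'a. (0 :: 'a, c) + (u, 0 :: 'b))"
    "polynomial_function (\<lambda>u :: 'a. (c, 0 :: 'a) + (0 :: 'b, u))"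
    by (intro polynomial_function_add polynomial_function_const
        polynomial_function_bounded_linear bounded_linear_Pair bounded_linear_zero
        bounded_linear_ident)+
  then show "polynomial_function (\<lambda>u :: 'a. (u, c))" "polynomial_function (\<lambda>u :: 'a. (c, u))"
    by simp_all
qed

text \<open>Let \<open>f (x, y) \<noteq> 0\<close>. Since \<open>X\<close> is generic, \<open>f (X, y) \<noteq> 0\<close> almost surely; then
  \<open>f (X, \<cdot>)\<close> is a nonzero polynomial, and an independent generic \<open>Y\<close> avoids its zeros.\<close>

lemma (in prob_space) generic_Pair:
  fixes X Y :: "'a \<Rightarrow> 'b::euclidean_space"
  assumes indep: "indep_var borel X borel Y" and X: "generic M X" and Y: "generic M Y"
  shows "generic M (\<lambda>w. (X w, Y w))"
  unfolding generic_def
proof (intro allI impI)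
  fix f :: "'b \<times> 'b \<Rightarrow> real" and q
  assume f: "real_polynomial_function f" "f q \<noteq> 0"
  note slice = real_polynomial_function_comp [OF polynomial_function_Pair_const(1) f(1)]
    real_polynomial_function_comp [OF polynomial_function_Pair_const(2) f(1)]
  have [measurable]: "f \<in> borel_measurable (borel \<Otimes>\<^sub>M borel)"
    using borel_measurable_real_polynomial_function [OF f(1)] by (simp add: borel_prod)
  have "AE w in M. f (X w, snd q) \<noteq> 0"
    using f(2) by (intro genericD [OF X slice(1), where x = "fst q"]) simp
  then have "AE w in M. AE w' in M. f (X w, Y w') \<noteq> 0"
    by eventually_elim (rule genericD [OF Y slice(2)])
  then show "AE w in M. f (X w, Y w) \<noteq> 0"
    by (intro AE_indep_decouple [OF indep, where P = "\<lambda>q. f q \<noteq> 0"]) measurable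
qed

text \<open>Fix a point \<open>x\<close> where the polynomial does not vanish and replace its coordinates by the
  random ones, one at a time. Each replacement is the argument for pairs, applied to the
  coordinates already replaced and the new one.\<close>

lemma (in prob_space) generic_vec:
  fixes X :: "'i::finite \<Rightarrow> 'a \<Rightarrow> 'b::euclidean_space"
  assumes indep: "indep_vars (\<lambda>_. borel) X UNIV" and X: "\<And>i. generic M (X i)"
  shows "generic M (\<lambda>w. \<chi> i. X i w)"
  unfolding generic_def
proof (intro allI impI)
  fix f :: "'b ^ 'i \<Rightarrow> real" and x
  assume f: "real_polynomial_function f" "f x \<noteq> 0"
  have "AE w in M. f (\<chi> k. if k \<in> S then X k w else x $ k) \<noteq> 0" for S
  proof (induction S rule: finite_induct [OF finite])
    case 1
    then show ?case using f(2) by simp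
  next
    case (2 i S)
    define U where "U p = (\<chi> k. if k \<in> S then p k else x $ k)" for p :: "'i \<Rightarrow> 'b"
    define L where "L q = (\<chi> k. if k = i then snd q else fst q $ k)" for q :: "('b ^ 'i) \<times> 'b"
    have "linear L"
      by (rule linearI) (auto simp: L_def vec_eq_iff)
    then have L: "polynomial_function L"
      by (simp add: polynomial_function_bounded_linear linear_conv_bounded_linear)
    have Um: "U \<in> borel_measurable (PiM S (\<lambda>_. borel))"
    proof (subst borel_measurable_euclidean_space, intro ballI)
      fix b :: "'b ^ 'i" assume "b \<in> Basis"
      then obtain k u where "b = axis k u"
        by (auto simp: Basis_vec_def)
      then have "(\<lambda>p. U p \<bullet> b) = (\<lambda>p. (if k \<in> S then p k else x $ k) \<bullet> u)"
        by (simp add: U_def inner_axis)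
      then show "(\<lambda>p. U p \<bullet> b) \<in> borel_measurable (PiM S (\<lambda>_. borel))"
        by (cases "k \<in> S") simp_all
    qed
    note Um [measurable]
    have [measurable]: "f \<in> borel_measurable borel" "L \<in> borel_measurable (borel \<Otimes>\<^sub>M borel)"
      using borel_measurable_real_polynomial_function [OF f(1)]
        borel_measurable_continuous_onI [OF continuous_on_polymonial_function [OF L]]
      by (simp_all add: borel_prod)
    let ?XS = "\<lambda>w. restrict (\<lambda>k. X k w) S" and ?Xi = "\<lambda>w. restrict (\<lambda>k. X k w) {i}"
    \<comment> \<open>\<open>U\<close> is the point with the coordinates in \<open>S\<close> replaced, and \<open>L\<close> overwrites its
      coordinate \<open>i\<close>; overwriting by \<open>x $ i\<close> changes nothing, so the induction hypothesis
      gives a point where the polynomial in coordinate \<open>i\<close> does not vanish.\<close>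
    have "L (U (?XS w), x $ i) = (\<chi> k. if k \<in> S then X k w else x $ k)" for w
      using 2 by (auto simp: L_def U_def vec_eq_iff)
    then have "AE w in M. f (L (U (?XS w), x $ i)) \<noteq> 0"
      using 2 by simp
    then have "AE w in M. AE w' in M. f (L (U (?XS w), X i w')) \<noteq> 0"
      by eventually_elim
         (rule genericD [OF X real_polynomial_function_comp [OF
              polynomial_function_Pair_const(2) real_polynomial_function_comp [OF L f(1)]]])
    then have "AE w in M. f (L (U (?XS w), ?Xi w i)) \<noteq> 0"
      using 2 AE_indep_decouple [OF indep_var_restrict [OF indep, of S "{i}"],
            where P = "\<lambda>q. f (L (U (fst q), snd q i)) \<noteq> 0"]
      by simp
    moreover have "L (U (?XS w), ?Xi w i) = (\<chi> k. if k \<in> insert i S then X k w else x $ k)" for w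
      by (auto simp: L_def U_def vec_eq_iff)
    ultimately show ?case
      by simp
  qed
  from this [of UNIV] show "AE w in M. f (\<chi> i. X i w) \<noteq> 0"
    by simp
qed

lemma (in prob_space) generic_std_gaussian_vector:
  assumes "std_gaussian_vector M g"
  shows "generic M g"
proof -
  have "generic M (\<lambda>w. \<chi> i. g w $ i)"
    using assms unfolding std_gaussian_vector_def
    by (intro generic_vec generic_if_density) auto
  then show ?thesis by simp
qed

lemma (in prob_space) generic_complex_gaussian_vector:
  fixes X :: "'a \<Rightarrow> complex ^ 'n::finite"
  assumes "complex_gaussian_vector M X"
  shows "generic M X"
proof -
  obtain g h where g: "std_gaussian_vector M g" and h: "std_gaussian_vector M h"
    and indep: "indep_var borel g borel h"
    and X: "\<And>w. w \<in> space M \<Longrightarrow> X w = (\<chi> i. Complex (g w $ i / sqrt 2) (h w $ i / sqrt 2))"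
    using assms unfolding complex_gaussian_vector_def by blast
  define L where "L q = (\<chi> i. Complex (fst q $ i / sqrt 2) (snd q $ i / sqrt 2))"
    for q :: "(real ^ 'n) \<times> (real ^ 'n)"
  have "linear L"
    by (rule linearI) (auto simp: L_def vec_eq_iff complex_eq_iff add_divide_distrib)
  then have "polynomial_function L"
    by (simp add: polynomial_function_bounded_linear linear_conv_bounded_linear)
  moreover have "L (\<chi> i. sqrt 2 * Re (v $ i), \<chi> i. sqrt 2 * Im (v $ i)) = v" for v
    by (simp add: L_def vec_eq_iff)
  then have "surj L"
    by (rule surjI)
  moreover have "X w = L (g w, h w)" if "w \<in> space M" for w
    using that by (simp add: X L_def)
  moreover have "generic M (\<lambda>w. (g w, h w))"
    using generic_Pair indep generic_std_gaussian_vector g h by blast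
  ultimately show ?thesis
    by (rule generic_compose [rotated])
qed

section \<open>A polynomial that detects spanning families\<close>

text \<open>The matrix of \<open>d \<mapsto> \<Sum>\<^sub>j (r\<^sub>j \<bullet> d) r\<^sub>j\<close>. Its determinant expresses by a
  single polynomial that the vectors \<open>r\<^sub>j\<close> span the space, whatever their number.\<close>

definition frame_matrix :: "('j::finite \<Rightarrow> real ^ 'k::finite) \<Rightarrow> real ^ 'k ^ 'k" where
  "frame_matrix r = (\<chi> s t. \<Sum>j\<in>UNIV. r j $ s * r j $ t)"

lemma frame_matrix_mult: "frame_matrix r *v d = (\<Sum>j\<in>UNIV. (r j \<bullet> d) *\<^sub>R r j)"
  by (simp add: vec_eq_iff frame_matrix_def matrix_vector_mult_def inner_vec_def sum_distrib_left
      sum_distrib_right) (subst sum.swap, simp add: mult_ac)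

text \<open>A kernel vector \<open>d\<close> satisfies \<open>\<Sum>\<^sub>j (r\<^sub>j \<bullet> d)\<^sup>2 = 0\<close>.\<close>

lemma det_frame_matrix_nonzero_iff: "det (frame_matrix r) \<noteq> 0 \<longleftrightarrow> (\<forall>d. (\<forall>j. r j \<bullet> d = 0) \<longrightarrow> d = 0)"
proof -
  have "frame_matrix r *v d = 0 \<longleftrightarrow> (\<forall>j. r j \<bullet> d = 0)" for d
  proof
    assume "frame_matrix r *v d = 0"
    then have "(\<Sum>j\<in>UNIV. (r j \<bullet> d) *\<^sub>R r j) \<bullet> d = 0"
      by (simp add: frame_matrix_mult)
    then have "(\<Sum>j\<in>UNIV. (r j \<bullet> d)\<^sup>2) = 0"
      by (simp add: inner_sum_left power2_eq_square)
    then show "\<forall>j. r j \<bullet> d = 0"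
      by (simp add: sum_nonneg_eq_0_iff)
  qed (simp add: frame_matrix_mult)
  then show ?thesis
    by (simp add: invertible_det_nz [symmetric] invertible_left_inverse matrix_left_invertible_ker)
qed

lemma real_polynomial_function_det_frame_matrix:
  assumes "\<And>j s. real_polynomial_function (\<lambda>x. r x j $ s)"
  shows "real_polynomial_function (\<lambda>x. det (frame_matrix (r x)))"
  unfolding det_def frame_matrix_def
  by (intro real_polynomial_function_sum real_polynomial_function_prod
      real_polynomial_function.intros(2,4))
     (auto simp: finite_permutations intro!: assms)

section \<open>The span of the rows of the Gauss-Newton system\<close>

definition realify :: "complex ^ 'n \<Rightarrow> real ^ ('n + 'n)" where
  "realify v = (\<chi> s. case s of Inl i \<Rightarrow> Re (v $ i) | Inr i \<Rightarrow> Im (v $ i))"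

lemma inner_realify: "realify u \<bullet> realify v = u \<bullet> v"
  by (simp add: realify_def inner_vec_def sum_UNIV_sum inner_complex_def sum.distrib)

lemma realify_eq_0_iff: "realify v = 0 \<longleftrightarrow> v = 0"
  by (metis inner_eq_zero_iff inner_realify)

lemma realify_surj: "\<exists>v. d = realify v"
  by (rule exI [of _ "\<chi> i. Complex (d $ Inl i) (d $ Inr i)"])
     (simp add: realify_def vec_eq_iff split: sum.split)

text \<open>The real gradient direction \<open>a a\<^sup>* z\<close> of \<open>\<bar>a\<^sup>* z\<bar>\<^sup>2 / 2\<close>, where \<open>a\<close> is the
  argument \<open>u\<close>: up to a nonzero factor, a row of the Gauss-Newton system maps \<open>d\<close> to its
  real inner product with this vector.\<close>

abbreviation gn_row :: "complex ^ 'n::finite \<Rightarrow> complex ^ 'n \<Rightarrow> complex ^ 'n" where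
  "gn_row z u \<equiv> cdot u z *s u"

lemma cdot_scale: "cdot (c *s u) v = cnj c * cdot u v" "cdot u (c *s v) = c * cdot u v"
  by (simp_all add: cdot_def sum_distrib_left mult_ac)

lemma gn_row_inner: "gn_row z u \<bullet> d = Re (cdot z u * cdot u d)"
  by (simp add: inner_eq_Re_cdot cdot_scale cnj_cdot)

lemma ii_inner: "(\<i> *s z) \<bullet> d = Im (cdot z d)"
  by (simp add: inner_eq_Re_cdot cdot_scale)

text \<open>Testing with \<open>u = z\<close> and with the phase direction \<open>\<i> z\<close> gives \<open>z\<^sup>* d = 0\<close>; then
  \<open>u = z + d\<close> gives \<open>\<bar>z\<bar>\<^sup>2 \<bar>d\<bar>\<^sup>2 = 0\<close>.\<close>

lemma gn_rows_determine:
  assumes z: "z \<noteq> 0" and rows: "\<And>u. gn_row z u \<bullet> d = 0" and phase: "(\<i> *s z) \<bullet> d = 0"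
  shows "d = 0"
proof -
  have rows': "Re (cdot z u * cdot u d) = 0" for u
    using rows [of u] unfolding gn_row_inner .
  have "Re (cdot z d) = 0"
    using rows' [of z] z by (simp add: cdot_self)
  moreover have "Im (cdot z d) = 0"
    using phase by (simp add: ii_inner)
  ultimately have zd: "cdot z d = 0"
    by (simp add: complex_eq_iff)
  then have "cdot d z = 0"
    by (metis cnj_cdot complex_cnj_zero)
  then show "d = 0"
    using rows' [of "z + d"] z zd by (simp add: cdot_add cdot_self)
qed

text \<open>The vectors \<open>gn_row z u\<close> lie in the real hyperplane orthogonal to \<open>\<i> z\<close>, whose dimension
  is \<open>2 n - 1 \<le> m\<close>. So \<open>m\<close> of them suffice to contain a basis of the span of all.\<close>

lemma gn_row_witness:
  fixes z :: "complex ^ 'n::finite"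
  assumes z: "z \<noteq> 0" and card: "2 * CARD('n) \<le> CARD('m::finite) + 1"
  shows "\<exists>e :: 'm \<Rightarrow> complex ^ 'n.
    \<forall>d. (\<forall>j. gn_row z (e j) \<bullet> d = 0) \<longrightarrow> (\<i> *s z) \<bullet> d = 0 \<longrightarrow> d = 0"
proof -
  let ?V = "range (gn_row z)"
  have "?V \<subseteq> {v. (\<i> *s z) \<bullet> v = 0}"
    by (auto simp: ii_inner cdot_scale simp flip: cnj_cdot [of z])
  then have "dim ?V \<le> dim {v. (\<i> *s z) \<bullet> v = 0}"
    by (rule dim_subset)
  moreover have "\<i> *s z \<noteq> 0"
    using z by (simp add: vec_eq_iff)
  then have "dim {v. (\<i> *s z) \<bullet> v = 0} = DIM(complex ^ 'n) - 1"
    by (rule dim_hyperplane)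
  ultimately have dim: "dim ?V \<le> CARD('m)"
    using card by simp
  obtain B where B: "B \<subseteq> ?V" "independent B" "?V \<subseteq> span B" "card B = dim ?V"
    by (rule basis_exists)
  then have "finite B"
    by (simp add: independent_imp_finite)
  then obtain g :: "complex ^ 'n \<Rightarrow> 'm" where g: "inj_on g B"
    using card_le_inj [OF \<open>finite B\<close> finite [of "UNIV :: 'm set"]] B(4) dim by auto
  define e where "e j = inv (gn_row z) (inv_into B g j)" for j
  have e: "gn_row z (e (g b)) = b" if "b \<in> B" for b
    unfolding e_def inv_into_f_f [OF g that] using B(1) that by (intro f_inv_into_f) (rule subsetD)
  have "d = 0" if d: "\<forall>j. gn_row z (e j) \<bullet> d = 0" and phase: "(\<i> *s z) \<bullet> d = 0" for d
  proof (rule gn_rows_determine [OF z _ phase])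
    fix u
    have "orthogonal d b" if "b \<in> B" for b
      using d [rule_format, of "g b"] unfolding e [OF that]
      by (simp add: orthogonal_def inner_commute)
    moreover have "gn_row z u \<in> span B"
      using B(3) by blast
    ultimately have "orthogonal d (gn_row z u)"
      by (rule orthogonal_to_span [rotated])
    then show "gn_row z u \<bullet> d = 0"
      by (simp add: orthogonal_def inner_commute)
  qed
  then show ?thesis by blast
qed

lemma real_polynomial_function_if_linear:
  fixes f :: "'a::euclidean_space \<Rightarrow> real"
  shows "linear f \<Longrightarrow> real_polynomial_function f"
  by (simp add: linear_conv_bounded_linear real_polynomial_function.intros(1))

lemma real_polynomial_function_gn_row:
  fixes z :: "complex ^ 'n::finite" and j :: "'m::finite"
  shows "real_polynomial_function (\<lambda>a. realify (gn_row z (a $ j)) $ s)"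
proof -
  have lin: "linear (\<lambda>a. Re (cdot (a $ j) z))" "linear (\<lambda>a. Im (cdot (a $ j) z))"
    "linear (\<lambda>a. Re (a $ j $ i))" "linear (\<lambda>a. Im (a $ j $ i))" for i :: 'n
    by (rule linearI; simp add: cdot_def algebra_simps sum.distrib sum_distrib_left sum_subtractf)+
  note poly = lin [THEN real_polynomial_function_if_linear]
  show ?thesis
    by (cases s) (auto simp: realify_def intro!: poly real_polynomial_function.intros(3,4)
        real_polynomial_function_diff)
qed

text \<open>The determinant of the frame matrix of \<open>\<i> z\<close> and the \<open>m\<close> rows is a polynomial in the
  sampling vectors. It does not vanish identically by \<open>gn_row_witness\<close>, so it is almost
  surely nonzero at a generic sample.\<close>

lemma (in prob_space) AE_gn_rows_determine:
  fixes a :: "'m::finite \<Rightarrow> 'a \<Rightarrow> complex ^ 'n::finite"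
  assumes generic: "generic M (\<lambda>w. \<chi> j. a j w)"
    and z: "z \<noteq> 0" and card: "2 * CARD('n) \<le> CARD('m) + 1"
  shows "AE w in M. \<forall>d. (\<forall>j. gn_row z (a j w) \<bullet> d = 0) \<longrightarrow> (\<i> *s z) \<bullet> d = 0 \<longrightarrow> d = 0"
proof -
  define r where "r p k = realify (case k of None \<Rightarrow> \<i> *s z | Some j \<Rightarrow> gn_row z (p $ j))"
    for p :: "(complex ^ 'n) ^ 'm" and k
  have iff: "det (frame_matrix (r p)) \<noteq> 0 \<longleftrightarrow>
      (\<forall>d. (\<forall>j. gn_row z (p $ j) \<bullet> d = 0) \<longrightarrow> (\<i> *s z) \<bullet> d = 0 \<longrightarrow> d = 0)" for p
  proof -
    have "(\<forall>k. r p k \<bullet> realify d = 0) \<longleftrightarrow>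
        (\<forall>j. gn_row z (p $ j) \<bullet> d = 0) \<and> (\<i> *s z) \<bullet> d = 0" for d
      unfolding r_def inner_realify by (auto split: option.splits)
    then show ?thesis
      unfolding det_frame_matrix_nonzero_iff by (metis realify_surj realify_eq_0_iff)
  qed
  obtain e :: "'m \<Rightarrow> complex ^ 'n"
    where e: "\<And>d. (\<forall>j. gn_row z (e j) \<bullet> d = 0) \<Longrightarrow> (\<i> *s z) \<bullet> d = 0 \<Longrightarrow> d = 0"
    using gn_row_witness [OF z card] by blast
  have "det (frame_matrix (r (\<chi> j. e j))) \<noteq> 0"
    unfolding iff using e by simp
  moreover have "real_polynomial_function (\<lambda>p. r p k $ s)" for k s
    by (cases k) (simp_all add: r_def real_polynomial_function_gn_row real_polynomial_function.intros(2))
  then have "real_polynomial_function (\<lambda>p. det (frame_matrix (r p)))"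
    by (rule real_polynomial_function_det_frame_matrix)
  ultimately have "AE w in M. det (frame_matrix (r (\<chi> j. a j w))) \<noteq> 0"
    using genericD [OF generic] by blast
  then show ?thesis
    unfolding iff by simp
qed

theorem lemma2p2:
  fixes M :: "'w measure"
    and a :: "'m::finite \<Rightarrow> 'w \<Rightarrow> complex ^ 'n::finite"
    and y :: "'m \<Rightarrow> 'w \<Rightarrow> real"
    and x z :: "complex ^ 'n"
  assumes "prob_space M"
    and "prob_space.indep_vars M (\<lambda>_. borel) a UNIV"
    and "\<And>j. complex_gaussian_vector M (a j)"
    and "\<And>j w. w \<in> space M \<Longrightarrow> y j w = (cmod (cdot (a j w) x))\<^sup>2"
  shows "(\<forall>w\<in>space M.
            gn_solution (\<lambda>j. a j w) (\<lambda>j. y j w) z (gn_step (\<lambda>j. a j w) (\<lambda>j. y j w) z) \<and>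
            (\<forall>d. gn_solution (\<lambda>j. a j w) (\<lambda>j. y j w) z d \<longrightarrow>
               d \<noteq> gn_step (\<lambda>j. a j w) (\<lambda>j. y j w) z \<longrightarrow>
               norm (gn_step (\<lambda>j. a j w) (\<lambda>j. y j w) z) < norm d)) \<and>
         (z \<noteq> 0 \<longrightarrow> 2 * CARD('n) \<le> CARD('m) + 1 \<longrightarrow>
           (AE w in M. \<forall>d. gn_solution (\<lambda>j. a j w) (\<lambda>j. y j w) z d \<longleftrightarrow>
              d = gn_step (\<lambda>j. a j w) (\<lambda>j. y j w) z))"
proof (intro conjI ballI allI impI)
  fix w
  show "gn_solution (\<lambda>j. a j w) (\<lambda>j. y j w) z (gn_step (\<lambda>j. a j w) (\<lambda>j. y j w) z)"
    by (rule gn_solution_gn_step)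
next
  fix w d
  assume "gn_solution (\<lambda>j. a j w) (\<lambda>j. y j w) z d" "d \<noteq> gn_step (\<lambda>j. a j w) (\<lambda>j. y j w) z"
  then show "norm (gn_step (\<lambda>j. a j w) (\<lambda>j. y j w) z) < norm d"
    by (rule gn_step_min_norm)
next
  assume z: "z \<noteq> 0" and card: "2 * CARD('n) \<le> CARD('m) + 1"
  interpret prob_space M by fact
  have "generic M (\<lambda>w. \<chi> j. a j w)"
    using assms(2,3) by (intro generic_vec generic_complex_gaussian_vector)
  from AE_gn_rows_determine [OF this z card]
  show "AE w in M. \<forall>d. gn_solution (\<lambda>j. a j w) (\<lambda>j. y j w) z d \<longleftrightarrow>
      d = gn_step (\<lambda>j. a j w) (\<lambda>j. y j w) z"
  proof eventually_elim
    case (elim w)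
    show ?case
    proof (intro allI iffI)
      fix d
      let ?step = "gn_step (\<lambda>j. a j w) (\<lambda>j. y j w) z"
      assume sol: "gn_solution (\<lambda>j. a j w) (\<lambda>j. y j w) z d"
      \<comment> \<open>Both points are solutions, so their difference is annihilated by all rows and, as
        both are feasible, orthogonal to the phase direction.\<close>
      then have "\<forall>j. gn_row z (a j w) \<bullet> (d - ?step) = 0"
        by (simp add: gn_solution_iff gn_matrix_with_conj_eq_0_iff gn_row_inner)
      moreover have "Im (cdot (d - ?step) z) = 0"
        using sol gn_feasible_gn_step [of z "\<lambda>j. a j w" "\<lambda>j. y j w"]
        by (simp add: gn_solution_iff gn_feasible_def cdot_diff)
      then have "(\<i> *s z) \<bullet> (d - ?step) = 0"
        using cnj_cdot [of "d - ?step" z] by (simp add: ii_inner complex_eq_iff)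
      ultimately have "d - ?step = 0"
        using elim by blast
      then show "d = ?step" by simp
    qed (simp add: gn_solution_gn_step)
  qed
qed

end
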